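(* Let $(G,N,\odot_N)$ be a skew bracoid that is almost a brace with respect to $H$, and let $S=\mathrm{Stab}_G(e_N)$. Let $(S,M,\odot_M)$ be a skew bracoid (with multiplicative group $S$). Let $N\times M$ be the external direct product of the groups $N$ and $M$, let $\pi:G\to S$ be the natural projection coming from $G=HS\cong H\rtimes S$ (i.e. $\pi(hs)=s$ for $h\in H$, $s\in S$), and define $$g\odot(\eta,\mu):=(g\odot_N\eta,\ \pi(g)\odot_M\mu)\qquad (g\in G,\ (\eta,\mu)\in N\times M).$$ Then $\odot$ is an action of $G$ on $N\times M$, and $(G,N\times M,\odot)$ is a skew bracoid.
   Context: A skew bracoid $(G,\cdot,N,\star,\odot)$, written $(G,N,\odot)$ or $(G,N)$, consists of two groups $(G,\cdot)$ (multiplicative) and $(N,\star)$ (additive, not necessarily abelian) and a transitive action $\odot$ of $G$ on the set $N$ such that $g\odot(\eta_1\star\eta_2)=(g\odot\eta_1)\star(g\odot e_N)^{-1}\star(g\odot\eta_2)$ for all $g\in G$, $\eta_1,\eta_2\in N$, where $e_N$ is the identity of $N$ and the inverse is taken in $N$. Let $S=\mathrm{Stab}_G(e_N)$. The skew bracoid $(G,N)$ is almost a brace with respect to $H$ if $H$ is a normal complement to $S$ in $G$, i.e. $H$ is a normal subgroup of $G$ with $G=HS$ and $H\cap S=\{e_G\}$, so that $G$ decomposes as a semi-direct product $H\rtimes S$. *)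

theory Defs
  imports "HOL-Algebra.Group_Action"
begin

text \<open>
  Group actions are those of \<^theory>\<open>HOL-Algebra.Group_Action\<close>: a homomorphism from \<open>G\<close> into the
  group of bijections of a set, whose elements are functions that are extensional on that set.
  The value \<open>act g \<eta>\<close> is the result of letting \<open>g\<close> act on \<open>\<eta>\<close>.
\<close>

locale skew_bracoid =
  G: group G + N: group N + transitive_action G "carrier N" act
  for G (structure) and N (structure) and act +
  assumes act_mult:
    "\<lbrakk>g \<in> carrier G; \<eta>1 \<in> carrier N; \<eta>2 \<in> carrier N\<rbrakk>
      \<Longrightarrow> act g (\<eta>1 \<otimes>\<^bsub>N\<^esub> \<eta>2)
          = act g \<eta>1 \<otimes>\<^bsub>N\<^esub> inv\<^bsub>N\<^esub> (act g \<one>\<^bsub>N\<^esub>) \<otimes>\<^bsub>N\<^esub> act g \<eta>2"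

definition normal_complement :: "('a, 'c) monoid_scheme \<Rightarrow> 'a set \<Rightarrow> 'a set \<Rightarrow> bool" where
  "normal_complement G H S \<longleftrightarrow>
     H \<lhd> G \<and> H <#>\<^bsub>G\<^esub> S = carrier G \<and> H \<inter> S = {\<one>\<^bsub>G\<^esub>}"

locale almost_brace = skew_bracoid G N act
  for G (structure) and N (structure) and act +
  fixes H
  assumes normal_complement: "normal_complement G H (stabilizer G act \<one>\<^bsub>N\<^esub>)"

definition complement_proj :: "('a, 'c) monoid_scheme \<Rightarrow> 'a set \<Rightarrow> 'a set \<Rightarrow> 'a \<Rightarrow> 'a" where
  "complement_proj G H S g = (THE s. s \<in> S \<and> (\<exists>h\<in>H. g = h \<otimes>\<^bsub>G\<^esub> s))"

lemma complement_proj_mult: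
  fixes G (structure)
  assumes "group G" "subgroup S G" "normal_complement G H S" "h \<in> H" "s \<in> S"
  shows "complement_proj G H S (h \<otimes> s) = s"
proof -
  interpret group G by fact
  interpret S: subgroup S G by fact
  have H: "subgroup H G" and int: "H \<inter> S = {\<one>}"
    using assms(3) by (auto simp: normal_complement_def normal_def)
  interpret H: subgroup H G by (rule H)
  have "s' = s" if "s' \<in> S" "h' \<in> H" and eq: "h \<otimes> s = h' \<otimes> s'" for s' h'
  proof -
    have "inv h' \<otimes> (h \<otimes> s) = s'"
      using that assms by (simp add: m_assoc [symmetric])
    then have "inv h' \<otimes> h \<otimes> s = s'"
      using that assms by (simp add: m_assoc)
    then have e: "inv h' \<otimes> h = s' \<otimes> inv s"
      using that assms by (metis H.mem_carrier S.mem_carrier inv_closed inv_solve_right' m_closed)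
    have "inv h' \<otimes> h \<in> H" "s' \<otimes> inv s \<in> S"
      using that assms by auto
    then have "s' \<otimes> inv s = \<one>"
      using int e by auto
    then show ?thesis
      using that assms by (metis S.mem_carrier inv_closed inv_equality inv_inv)
  qed
  then show ?thesis
    unfolding complement_proj_def using assms by (intro the_equality) auto
qed

text \<open>The restriction makes each \<open>prod_act \<pi> N M actN actM g\<close> extensional, as required by
  \<^const>\<open>Bij\<close>.\<close>

definition prod_act ::
    "('a \<Rightarrow> 's) \<Rightarrow> ('b, 'd) monoid_scheme \<Rightarrow> ('c, 'e) monoid_scheme
      \<Rightarrow> ('a \<Rightarrow> 'b \<Rightarrow> 'b) \<Rightarrow> ('s \<Rightarrow> 'c \<Rightarrow> 'c) \<Rightarrow> 'a \<Rightarrow> 'b \<times> 'c \<Rightarrow> 'b \<times> 'c" where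
  "prod_act \<pi> N M actN actM g =
     (\<lambda>(\<eta>, \<mu>) \<in> carrier (N \<times>\<times> M). (actN g \<eta>, actM (\<pi> g) \<mu>))"

end

theory Submission
  imports Defs
begin

text \<open>
  The product action is the diagonal one, with \<open>G\<close> acting on \<open>M\<close> through \<open>\<pi>\<close>. It is an action
  because \<open>\<pi>\<close> is a homomorphism (\<open>group_action_prod_act\<close>), and this is where normality of the
  complement \<open>H\<close> enters: to rewrite \<open>h s h' s'\<close> as a product of an element of \<open>H\<close> and one of \<open>S\<close>, the
  factor \<open>h'\<close> has to be moved past \<open>s\<close> (\<open>complement_proj_hom\<close>). The skew bracoid identity involves
  only one group element, and \<open>prod_act \<dots> g\<close> and the operations of \<open>N \<times>\<times> M\<close> are all componentwise,
  so it is the conjunction of the identity for \<open>g\<close> on \<open>N\<close> and the identity for \<open>\<pi> g\<close> on \<open>M\<close>.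

  The point that is special to the situation is transitivity: a diagonal action on a product of
  transitive \<open>G\<close>-sets is rarely transitive. Here the two factors of \<open>G = H S\<close> control the two
  coordinates of the base point \<open>(\<one>\<^bsub>N\<^esub>, \<one>\<^bsub>M\<^esub>)\<close> independently. An element \<open>s\<close> of \<open>S\<close> fixes \<open>\<one>\<^bsub>N\<^esub>\<close>, and
  \<open>s \<odot> \<one>\<^bsub>M\<^esub>\<close> is arbitrary since \<open>S\<close> is transitive on \<open>M\<close>; an element \<open>h\<close> of \<open>H\<close> acts trivially on \<open>M\<close>,
  and \<open>h \<odot> \<one>\<^bsub>N\<^esub>\<close> is arbitrary since a complement of a point stabilizer is itself transitive
  (\<open>complement_transitive\<close>). So \<open>h s\<close> moves the base point to any prescribed pair.
\<close>

text \<open>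
  An action may be checked pointwise: each map is automatically a bijection because the inverse
  element provides the inverse map.
\<close>

lemma group_actionI:
  fixes G (structure)
  assumes G: "group G"
    and ext: "\<And>g. g \<in> carrier G \<Longrightarrow> \<phi> g \<in> extensional E"
    and closed: "\<And>g x. \<lbrakk>g \<in> carrier G; x \<in> E\<rbrakk> \<Longrightarrow> \<phi> g x \<in> E"
    and one: "\<And>x. x \<in> E \<Longrightarrow> \<phi> \<one> x = x"
    and mult: "\<And>g h x. \<lbrakk>g \<in> carrier G; h \<in> carrier G; x \<in> E\<rbrakk> \<Longrightarrow> \<phi> (g \<otimes> h) x = \<phi> g (\<phi> h x)"
  shows "group_action G E \<phi>"
proof -
  interpret group G by (rule G)
  have bij: "\<phi> g \<in> Bij E" if g: "g \<in> carrier G" for g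
  proof -
    have "\<phi> (inv g) (\<phi> g x) = x" "\<phi> g (\<phi> (inv g) x) = x" if "x \<in> E" for x
      using mult[of "inv g" g x] mult[of g "inv g" x] one g that by simp_all
    then have "bij_betw (\<phi> g) E E"
      using closed g by (intro bij_betw_byWitness[where f' = "\<phi> (inv g)"]) auto
    then show ?thesis
      using ext g by (simp add: Bij_def)
  qed
  have "\<phi> (g \<otimes> h) = compose E (\<phi> g) (\<phi> h)" if "g \<in> carrier G" "h \<in> carrier G" for g h
    using that ext mult by (intro extensionalityI[of _ E]) (auto simp: compose_def)
  then have "\<phi> \<in> hom G (BijGroup E)"
    by (auto simp: hom_def BijGroup_def bij)
  then show ?thesis
    by (intro group_action.intro group_hom.intro G group_BijGroup) (simp add: group_hom_axioms_def)
qed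

lemma (in group_action) act_closed: "\<lbrakk>g \<in> carrier G; x \<in> E\<rbrakk> \<Longrightarrow> \<phi> g x \<in> E"
  using element_image by blast

lemma (in group_action) one_act: "x \<in> E \<Longrightarrow> \<phi> \<one> x = x"
  by (metis id_eq_one restrict_apply')

lemma (in group_action) transitive_from_base_point:
  assumes b: "b \<in> E" and reach: "\<And>x. x \<in> E \<Longrightarrow> \<exists>g\<in>carrier G. \<phi> g b = x"
  shows "transitive_action G E \<phi>"
proof
  interpret group G
    using group_hom group_hom.axioms(1) by blast
  fix x y assume "x \<in> E" "y \<in> E"
  then obtain g h where g: "g \<in> carrier G" "\<phi> g b = x" and h: "h \<in> carrier G" "\<phi> h b = y"
    using reach by blast
  have "\<phi> (inv g) x = b"
    using g(1) b g(2) by (rule orbit_sym_aux)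
  then have "\<phi> (h \<otimes> inv g) x = y"
    using composition_rule[OF \<open>x \<in> E\<close> h(1) inv_closed[OF g(1)]] h(2) by simp
  then show "\<exists>g\<in>carrier G. \<phi> g x = y"
    using g(1) h(1) by blast
qed

lemma normal_complement_decomp:
  fixes G (structure)
  assumes "normal_complement G H S" and "g \<in> carrier G"
  obtains h s where "h \<in> H" "s \<in> S" "g = h \<otimes> s"
  using assms unfolding normal_complement_def set_mult_def by blast

text \<open>The homomorphism is the one with kernel \<open>H\<close>, coming from \<open>G/H \<cong> S\<close>.\<close>

lemma complement_proj_hom:
  fixes G (structure)
  assumes S: "subgroup S G" and nc: "normal_complement G H S"
  shows "complement_proj G H S \<in> hom G (G\<lparr>carrier := S\<rparr>)"
proof -
  interpret H: normal H G
    using nc by (simp add: normal_complement_def)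
  interpret S: subgroup S G by (rule S)
  note proj = complement_proj_mult[OF H.is_group S nc]
  let ?\<pi> = "complement_proj G H S"
  have "?\<pi> g \<in> S" if "g \<in> carrier G" for g
    using normal_complement_decomp[OF nc that] proj by metis
  moreover have "?\<pi> (x \<otimes> y) = ?\<pi> x \<otimes> ?\<pi> y" if x: "x \<in> carrier G" and y: "y \<in> carrier G" for x y
  proof -
    obtain h s where hs: "h \<in> H" "s \<in> S" "x = h \<otimes> s"
      using normal_complement_decomp[OF nc x] .
    obtain h' s' where hs': "h' \<in> H" "s' \<in> S" "y = h' \<otimes> s'"
      using normal_complement_decomp[OF nc y] .
    have "inv s \<otimes> (s \<otimes> s') = s'"
      using hs hs' by (simp add: H.m_assoc[symmetric])
    \<comment> \<open>Moving \<open>h'\<close> to the left of \<open>s\<close> conjugates it by \<open>s\<close>.\<close>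
    then have "x \<otimes> y = (h \<otimes> (s \<otimes> h' \<otimes> inv s)) \<otimes> (s \<otimes> s')"
      using hs hs' by (simp add: H.m_assoc)
    moreover have "h \<otimes> (s \<otimes> h' \<otimes> inv s) \<in> H"
      using hs hs' by (simp add: H.inv_op_closed2)
    ultimately show ?thesis
      using hs hs' by (simp add: proj)
  qed
  ultimately show ?thesis
    by (auto simp: hom_def)
qed

text \<open>
  If \<open>g = h s\<close> moves the base point to \<open>x\<close> and \<open>s\<close> fixes the base point, then \<open>h\<close> alone does it.
\<close>

lemma (in transitive_action) complement_transitive:
  assumes nc: "normal_complement G H (stabilizer G \<phi> b)" and "b \<in> E" "x \<in> E"
  shows "\<exists>h\<in>H. \<phi> h b = x"
proof -
  obtain g where g: "g \<in> carrier G" "\<phi> g b = x"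
    using unique_orbit assms by blast
  obtain h s where hs: "h \<in> H" "s \<in> stabilizer G \<phi> b" "g = h \<otimes> s"
    using normal_complement_decomp[OF nc g(1)] .
  interpret H: normal H G
    using nc by (simp add: normal_complement_def)
  have s: "s \<in> carrier G" "\<phi> s b = b"
    using hs(2) by (auto simp: stabilizer_def)
  have "\<phi> g b = \<phi> h b"
    using composition_rule[OF \<open>b \<in> E\<close> H.mem_carrier[OF hs(1)] s(1)] s(2) hs(3) by simp
  with g(2) hs(1) show ?thesis
    by auto
qed

lemma prod_act_apply [simp]:
  "\<lbrakk>\<eta> \<in> carrier N; \<mu> \<in> carrier M\<rbrakk> \<Longrightarrow> prod_act \<pi> N M actN actM g (\<eta>, \<mu>) = (actN g \<eta>, actM (\<pi> g) \<mu>)"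
  by (simp add: prod_act_def)

lemma group_action_prod_act:
  assumes "group_action G (carrier N) actN" and "group_action K (carrier M) actM"
    and \<pi>: "\<pi> \<in> hom G K"
  shows "group_action G (carrier (N \<times>\<times> M)) (prod_act \<pi> N M actN actM)"
proof -
  interpret N: group_action G "carrier N" actN by fact
  interpret M: group_action K "carrier M" actM by fact
  have G: "group G" and K: "group K"
    using N.group_hom M.group_hom group_hom.axioms(1) by blast+
  interpret \<pi>: group_hom G K \<pi>
    by (intro group_hom.intro G K) (simp add: group_hom_axioms_def \<pi>)
  show ?thesis
    by (rule group_actionI[OF G])
       (auto simp: prod_act_def N.act_closed M.act_closed N.one_act M.one_act
          N.composition_rule M.composition_rule)
qed

lemma skew_bracoid_prod_act:
  assumes "skew_bracoid G N actN" and "skew_bracoid K M actM" and \<pi>: "\<pi> \<in> hom G K"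
    and trans: "transitive_action G (carrier (N \<times>\<times> M)) (prod_act \<pi> N M actN actM)"
  shows "skew_bracoid G (N \<times>\<times> M) (prod_act \<pi> N M actN actM)"
proof -
  interpret N: skew_bracoid G N actN by fact
  interpret M: skew_bracoid K M actM by fact
  have act_mult: "prod_act \<pi> N M actN actM g (x \<otimes>\<^bsub>N \<times>\<times> M\<^esub> y)
      = prod_act \<pi> N M actN actM g x
        \<otimes>\<^bsub>N \<times>\<times> M\<^esub> inv\<^bsub>N \<times>\<times> M\<^esub> (prod_act \<pi> N M actN actM g \<one>\<^bsub>N \<times>\<times> M\<^esub>)
        \<otimes>\<^bsub>N \<times>\<times> M\<^esub> prod_act \<pi> N M actN actM g y"
    if "g \<in> carrier G" "x \<in> carrier (N \<times>\<times> M)" "y \<in> carrier (N \<times>\<times> M)" for g x y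
  proof -
    have "\<pi> g \<in> carrier K"
      using \<pi> that by (simp add: hom_in_carrier)
    then have "actN g \<one>\<^bsub>N\<^esub> \<in> carrier N" "actM (\<pi> g) \<one>\<^bsub>M\<^esub> \<in> carrier M"
      using that by (simp_all add: N.act_closed M.act_closed)
    then show ?thesis
      using that \<open>\<pi> g \<in> carrier K\<close> by (auto simp: N.act_mult M.act_mult inv_DirProd)
  qed
  show ?thesis
    by (intro skew_bracoid.intro skew_bracoid_axioms.intro N.G.is_group trans act_mult
        DirProd_group N.N.is_group M.N.is_group)
qed

theorem theorem3p1:
  fixes G :: "('a, 'c) monoid_scheme"
    and N :: "('b, 'd) monoid_scheme"
    and M :: "('m, 'e) monoid_scheme"
    and actN :: "'a \<Rightarrow> 'b \<Rightarrow> 'b"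
    and actM :: "'a \<Rightarrow> 'm \<Rightarrow> 'm"
    and H S :: "'a set"
    and \<pi> :: "'a \<Rightarrow> 'a"
    and act :: "'a \<Rightarrow> 'b \<times> 'm \<Rightarrow> 'b \<times> 'm"
  defines "S \<equiv> stabilizer G actN \<one>\<^bsub>N\<^esub>"
    and "\<pi> \<equiv> complement_proj G H S"
    and "act \<equiv> prod_act \<pi> N M actN actM"
  assumes "almost_brace G N actN H"
    and "skew_bracoid (G\<lparr>carrier := S\<rparr>) M actM"
  shows "group_action G (carrier (N \<times>\<times> M)) act \<and> skew_bracoid G (N \<times>\<times> M) act"
proof -
  interpret N: almost_brace G N actN H by fact
  interpret M: skew_bracoid "G\<lparr>carrier := S\<rparr>" M actM by fact
  have nc: "normal_complement G H S"
    using N.normal_complement by (simp add: S_def)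
  have S: "subgroup S G"
    unfolding S_def by (rule N.stabilizer_subgroup) simp
  interpret S: subgroup S G by (rule S)
  interpret H: normal H G
    using nc by (simp add: normal_complement_def)
  have \<pi>: "\<pi> \<in> hom G (G\<lparr>carrier := S\<rparr>)"
    unfolding \<pi>_def using S nc by (rule complement_proj_hom)
  interpret P: group_action G "carrier (N \<times>\<times> M)" act
    unfolding act_def
    using N.group_action_axioms M.group_action_axioms \<pi> by (rule group_action_prod_act)
  have "transitive_action G (carrier (N \<times>\<times> M)) act"
  proof (rule P.transitive_from_base_point[where b = "(\<one>\<^bsub>N\<^esub>, \<one>\<^bsub>M\<^esub>)"])
    fix x assume "x \<in> carrier (N \<times>\<times> M)"
    then obtain \<eta> \<mu> where x: "x = (\<eta>, \<mu>)" "\<eta> \<in> carrier N" "\<mu> \<in> carrier M"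
      by auto
    obtain h where h: "h \<in> H" "actN h \<one>\<^bsub>N\<^esub> = \<eta>"
      using N.complement_transitive[OF N.normal_complement N.N.one_closed x(2)] by blast
    obtain s where s: "s \<in> S" "actM s \<one>\<^bsub>M\<^esub> = \<mu>"
      using M.unique_orbit[OF M.N.one_closed x(3)] by auto
    have "actN s \<one>\<^bsub>N\<^esub> = \<one>\<^bsub>N\<^esub>"
      using s(1) unfolding S_def stabilizer_def by blast
    then have "actN (h \<otimes>\<^bsub>G\<^esub> s) \<one>\<^bsub>N\<^esub> = \<eta>"
      using h s by (simp add: N.composition_rule)
    moreover have "\<pi> (h \<otimes>\<^bsub>G\<^esub> s) = s"
      unfolding \<pi>_def using N.G.is_group S nc h(1) s(1) by (rule complement_proj_mult)
    ultimately have "act (h \<otimes>\<^bsub>G\<^esub> s) (\<one>\<^bsub>N\<^esub>, \<one>\<^bsub>M\<^esub>) = x"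
      using s x by (simp add: act_def)
    moreover have "h \<otimes>\<^bsub>G\<^esub> s \<in> carrier G"
      using h(1) s(1) by simp
    ultimately show "\<exists>g\<in>carrier G. act g (\<one>\<^bsub>N\<^esub>, \<one>\<^bsub>M\<^esub>) = x" ..
  qed simp
  then have "skew_bracoid G (N \<times>\<times> M) act"
    unfolding act_def
    by (rule skew_bracoid_prod_act[OF N.skew_bracoid_axioms M.skew_bracoid_axioms \<pi>])
  with P.group_action_axioms show ?thesis ..
qed

end
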